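(* Let $k\ge1$ and let $f_1,f_2,\ldots,f_k$ be non-constant entire functions. Suppose that, for all $j\in\{1,2,\ldots,k\}$, $f_j$ has the annular domain property for some $m>1$. Suppose also that, for some $j\in\{1,2,\ldots,k\}$, $f_j$ is a log-regular transcendental entire function. Let $g=f_1\circ f_2\circ\cdots\circ f_k$. Then every component of the Fatou set $F(g)$ is bounded.
   Context: For an entire function $f$ put $M(r,f)=\max_{|z|=r}|f(z)|$ for $r>0$, and $B(0,r)=\{z\in\mathbb C:|z|<r\}$. The Fatou set $F(f)$ is the set of $z\in\mathbb C$ such that the iterates $(f^n)_{n\ge1}$ form a normal family in a neighbourhood of $z$. An entire function $f$ has the annular domain property for $m>1$ if there exists $R_0>0$ such that, for all $r\ge R_0$, there is a simply connected domain $G=G(r)$ with $B(0,r)\subset G\subset B(0,r^m)$ and $|f(z)|\ge M(r,f)$ for all $z\in\partial G$. A transcendental entire function $f$ is log-regular (with constant $c>0$) if $\phi(t)=\log M(e^t,f)$ satisfies $\phi'(t)/\phi(t)\ge (1+c)/t$ for all large $t$; it is log-regular if this holds for some $c>0$. (Since $\phi$ is convex, $\phi'$ exists outside a countable set; at exceptional points $\phi'$ is read as the right derivative.) *)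

theory Defs
  imports "HOL-Complex_Analysis.Complex_Analysis"
begin

abbreviation entire :: "(complex \<Rightarrow> complex) \<Rightarrow> bool" where
  "entire f \<equiv> f holomorphic_on UNIV"

definition transcendental_entire :: "(complex \<Rightarrow> complex) \<Rightarrow> bool" where
  "transcendental_entire f \<longleftrightarrow> entire f \<and> \<not> (\<exists>p. \<forall>z. f z = poly p z)"

(* The supremum is a maximum for continuous f and r > 0; the value is only used for such f and r. *)
definition max_modulus :: "real \<Rightarrow> (complex \<Rightarrow> complex) \<Rightarrow> real" where
  "max_modulus r f = (SUP z\<in>sphere 0 r. norm (f z))"

(* Montel's notion of normality for analytic functions: convergence is locally uniform, and
   locally uniform divergence to infinity is allowed. On a connected S this agrees with normality
   with respect to the spherical metric; hence the connectedness of U in fatou_set below, which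
   does not restrict the neighbourhoods, as they may be shrunk to discs. A finite limit g need
   not be required to be holomorphic, since a locally uniform limit of holomorphic functions is. *)
definition normal_family :: "(complex \<Rightarrow> complex) set \<Rightarrow> complex set \<Rightarrow> bool" where
  "normal_family \<F> S \<longleftrightarrow>
     (\<forall>h :: nat \<Rightarrow> complex \<Rightarrow> complex. range h \<subseteq> \<F> \<longrightarrow>
       (\<exists>\<sigma> :: nat \<Rightarrow> nat. strict_mono \<sigma> \<and>
         ((\<exists>g. \<forall>K. compact K \<and> K \<subseteq> S \<longrightarrow>
              uniform_limit K (\<lambda>n. h (\<sigma> n)) g sequentially) \<or>
          (\<forall>K. compact K \<and> K \<subseteq> S \<longrightarrow>
              (\<forall>B. \<forall>\<^sub>F n in sequentially. \<forall>z\<in>K. B \<le> norm (h (\<sigma> n) z))))))"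

definition fatou_set :: "(complex \<Rightarrow> complex) \<Rightarrow> complex set" where
  "fatou_set f =
     {z. \<exists>U. open U \<and> connected U \<and> z \<in> U \<and> normal_family {f ^^ n |n. n \<ge> 1} U}"

definition annular_domain_property :: "real \<Rightarrow> (complex \<Rightarrow> complex) \<Rightarrow> bool" where
  "annular_domain_property m f \<longleftrightarrow>
     (\<exists>R0>0. \<forall>r\<ge>R0. \<exists>G. open G \<and> connected G \<and> simply_connected G \<and>
        ball 0 r \<subseteq> G \<and> G \<subseteq> ball 0 (r powr m) \<and>
        (\<forall>z\<in>frontier G. norm (f z) \<ge> max_modulus r f))"

(* D is the right derivative of t \<mapsto> log M(e^t, f). For nonzero entire f this function is convex,
   so D exists, and it is the derivative wherever the function is differentiable. *)
definition log_regular_with :: "real \<Rightarrow> (complex \<Rightarrow> complex) \<Rightarrow> bool" where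
  "log_regular_with c f \<longleftrightarrow>
     (let \<phi> = (\<lambda>t::real. ln (max_modulus (exp t) f)) in
      \<forall>\<^sub>F t in at_top. \<exists>D. (\<phi> has_real_derivative D) (at_right t) \<and> D / \<phi> t \<ge> (1 + c) / t)"

definition log_regular :: "(complex \<Rightarrow> complex) \<Rightarrow> bool" where
  "log_regular f \<longleftrightarrow> (\<exists>c>0. log_regular_with c f)"

end

theory Submission
  imports Defs
begin

text \<open>A connected set that meets \<open>|z| \<le> r\<close> and \<open>|z| \<ge> r\<^sup>\<kappa>\<close> with \<open>\<kappa>\<close> large must cross the boundary of
  the domain \<open>G(r\<^bsup>\<kappa>/m\<^esup>)\<close>, so its image under \<open>f\<close> contains points of modulus at most \<open>M(r, f)\<close> and at
  least \<open>M(r\<^bsup>\<kappa>/m\<^esup>, f)\<close>. Up to constant factors, convexity of \<open>log M(e\<^sup>t, f)\<close> makes the new exponent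
  \<open>\<kappa>\<close> for each \<open>f\<^sub>j\<close>, and log-regularity raises it to \<open>\<kappa>\<^bsup>1+c\<^esup>\<close>, so that the exponent of \<open>g\<^sup>n\<close> tends to
  infinity. If a Fatou component were unbounded, one could take a path in it as the connected set.
  By normality a subsequence of \<open>g\<^sup>n\<close> tends to infinity on that path, whence \<open>log |g\<^sup>n|\<close> is eventually
  positive and harmonic near it, and Harnack's inequality bounds the exponents.\<close>

section \<open>Growth of the maximum modulus\<close>

definition log_max_modulus :: "(complex \<Rightarrow> complex) \<Rightarrow> real \<Rightarrow> real" where
  "log_max_modulus f t = ln (max_modulus (exp t) f)"

lemma max_modulus_attained:
  assumes "entire f" "r \<ge> 0"
  obtains z where "norm z = r" "norm (f z) = max_modulus r f"
proof -
  have "continuous_on (sphere 0 r) (\<lambda>z. norm (f z))"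
    using assms(1) by (intro continuous_on_norm holomorphic_on_imp_continuous_on)
      (auto intro: holomorphic_on_subset)
  moreover have "sphere (0::complex) r \<noteq> {}"
    using assms(2) by simp
  ultimately obtain z where z: "z \<in> sphere 0 r" "\<forall>w\<in>sphere 0 r. norm (f w) \<le> norm (f z)"
    using continuous_attains_sup[OF compact_sphere, of 0 r "\<lambda>z. norm (f z)"] by blast
  have "max_modulus r f = norm (f z)"
    unfolding max_modulus_def using z by (intro cSup_eq_maximum) auto
  with z show ?thesis by (intro that[of z]) auto
qed

lemma norm_le_max_modulus:
  assumes "entire f" "norm z \<le> r"
  shows "norm (f z) \<le> max_modulus r f"
proof (rule maximum_modulus_frontier[where S = "cball 0 r" and f = f])
  show "f holomorphic_on interior (cball 0 r)"
    using assms(1) holomorphic_on_subset by blast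
  show "continuous_on (closure (cball 0 r)) f"
    using assms(1) by (intro holomorphic_on_imp_continuous_on) (auto intro: holomorphic_on_subset)
  have "compact (sphere (0::complex) r)" "continuous_on (sphere 0 r) (\<lambda>z. norm (f z))"
    using assms(1) by (auto intro!: continuous_on_norm holomorphic_on_imp_continuous_on
        intro: holomorphic_on_subset)
  then have "bdd_above ((\<lambda>z. norm (f z)) ` sphere 0 r)"
    by (intro bounded_imp_bdd_above compact_imp_bounded compact_continuous_image)
  then show "norm (f w) \<le> max_modulus r f" if "w \<in> frontier (cball 0 r)" for w
    using that unfolding max_modulus_def by (intro cSUP_upper) auto
qed (use assms in auto)

lemma max_modulus_mono:
  assumes "entire f" "0 \<le> r" "r \<le> s"
  shows "max_modulus r f \<le> max_modulus s f"
proof -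
  obtain z where "norm z = r" "norm (f z) = max_modulus r f"
    using max_modulus_attained[OF assms(1,2)] .
  then show ?thesis
    using norm_le_max_modulus[OF assms(1), of z s] assms(3) by simp
qed

text \<open>If the maximum vanished, \<open>f\<close> would be zero on a disc and hence everywhere
  by the identity theorem. Positivity ensures that \<open>log_max_modulus\<close> is a genuine
  logarithm and not the default value of \<open>ln\<close> at 0.\<close>

lemma max_modulus_pos:
  assumes "entire f" "\<not> f constant_on UNIV" "r > 0"
  shows "max_modulus r f > 0"
proof (rule ccontr)
  assume "\<not> ?thesis"
  then have zero: "f z = 0" if "z \<in> ball 0 r" for z
    using norm_le_max_modulus[OF assms(1), of z r] that by (simp add: not_less) (metis norm_le_zero_iff order_trans)
  have "f z = 0" for z
    using zero assms by (intro analytic_continuation_open[of "ball 0 r" UNIV f "\<lambda>_. 0" z]) auto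
  then show False
    using assms(2) by (simp add: constant_on_def)
qed

lemma exp_log_max_modulus:
  assumes "entire f" "\<not> f constant_on UNIV"
  shows "exp (log_max_modulus f t) = max_modulus (exp t) f"
  using max_modulus_pos[OF assms] by (simp add: log_max_modulus_def)

lemma log_max_modulus_mono:
  assumes "entire f" "\<not> f constant_on UNIV" "s \<le> t"
  shows "log_max_modulus f s \<le> log_max_modulus f t"
  using max_modulus_mono[OF assms(1), of "exp s" "exp t"] assms(3)
  by (simp flip: exp_log_max_modulus[OF assms(1,2)])

text \<open>By Liouville's theorem some \<open>z\<close> has \<open>norm (f z) > exp B\<close>.
  Since \<open>exp t > t\<close>, every \<open>t\<close> from \<open>norm z\<close> on makes the
  disc of radius \<open>exp t\<close> contain \<open>z\<close>.\<close>

lemma log_max_modulus_at_top: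
  assumes "entire f" "\<not> f constant_on UNIV"
  shows "filterlim (log_max_modulus f) at_top at_top"
  unfolding filterlim_at_top
proof
  fix B
  have "\<not> bounded (range f)"
    using Liouville_theorem assms by blast
  then obtain z where z: "norm (f z) > exp B"
    unfolding bounded_iff by (metis imageE not_le)
  have "B \<le> log_max_modulus f t" if "t \<ge> norm z" for t
  proof -
    have "norm z \<le> exp t"
      using that exp_ge_add_one_self[of t] by linarith
    then have "exp B \<le> exp (log_max_modulus f t)"
      using z norm_le_max_modulus[OF assms(1), of z "exp t"]
      by (simp add: exp_log_max_modulus[OF assms])
    then show ?thesis by simp
  qed
  then show "\<forall>\<^sub>F t in at_top. B \<le> log_max_modulus f t"
    by (auto simp: eventually_at_top_linorder)
qed

text \<open>The maximum principle is applied to \<open>f z ^ q / z ^ p\<close> on the annulus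
  between radii 1 and \<open>R\<close>. By \<open>gt\<close> the value reached on the circle of
  radius \<open>r\<close> beats the bound on the inner circle, so the outer circle must dominate.
  Integer exponents keep the quotient single-valued and encode the slope p/q.\<close>

lemma three_circles_power:
  assumes f: "entire f" and "1 \<le> r" "r \<le> R" "q > 0"
    and gt: "max_modulus 1 f ^ q < max_modulus r f ^ q / r ^ p"
  shows "max_modulus r f ^ q / r ^ p \<le> max_modulus R f ^ q / R ^ p"
proof -
  define S where "S = {z::complex. 1 \<le> norm z \<and> norm z \<le> R}"
  define h where "h = (\<lambda>z. f z ^ q / z ^ p)"
  obtain z where z: "norm z = r" "norm (f z) = max_modulus r f"
    using max_modulus_attained[OF f, of r] assms by force
  have S: "closed S"
    unfolding S_def by (intro closed_Collect_conj closed_Collect_le continuous_intros)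
  have h: "h holomorphic_on S"
    unfolding h_def S_def
    by (intro holomorphic_intros holomorphic_on_subset[OF f]) auto
  have "open {z::complex. 1 < norm z \<and> norm z < R}"
    by (intro open_Collect_conj open_Collect_less continuous_intros)
  then have interior: "{z::complex. 1 < norm z \<and> norm z < R} \<subseteq> interior S"
    by (intro interior_maximal) (auto simp: S_def)
  have "norm (h z) \<le> max (max_modulus 1 f ^ q) (max_modulus R f ^ q / R ^ p)"
  proof (rule maximum_modulus_frontier[where S = S and f = h])
    show "h holomorphic_on interior S"
      using h interior_subset holomorphic_on_subset by blast
    show "continuous_on (closure S) h"
      using h S by (simp add: holomorphic_on_imp_continuous_on)
    show "bounded S"
      unfolding S_def bounded_iff by auto
    show "z \<in> S"
      using z assms by (auto simp: S_def)
    fix w assume "w \<in> frontier S"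
    then have w: "w \<in> S" "w \<notin> interior S"
      using S by (auto simp: frontier_def)
    have *: "norm (f w) ^ q \<le> max_modulus (norm w) f ^ q"
      by (intro power_mono norm_le_max_modulus f) auto
    consider "norm w = 1" | "norm w = R"
      using w interior by (force simp: S_def)
    then show "norm (h w) \<le> max (max_modulus 1 f ^ q) (max_modulus R f ^ q / R ^ p)"
    proof cases
      case 1
      with * show ?thesis
        by (simp add: h_def norm_divide norm_power)
    next
      case 2
      with * have "norm (h w) \<le> max_modulus R f ^ q / R ^ p"
        using assms by (simp add: h_def norm_divide norm_power divide_right_mono)
      then show ?thesis by simp
    qed
  qed
  moreover have "norm (h z) = max_modulus r f ^ q / r ^ p"
    using z by (simp add: h_def norm_divide norm_power)
  ultimately show ?thesis
    using gt by linarith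
qed

text \<open>Hadamard's convexity, tested with rational slopes: \<open>slope\<close> says that the
  chord over [0, t] is steeper than p/q, and then the graph to the right of \<open>t\<close> stays
  above the line of slope p/q through its point over \<open>t\<close>.\<close>

lemma log_max_modulus_three_circles:
  assumes f: "entire f" "\<not> f constant_on UNIV" and "0 \<le> t" "1 \<le> l" "q > 0"
    and slope: "real p * t < real q * (log_max_modulus f t - log_max_modulus f 0)"
  shows "real q * log_max_modulus f t + (l - 1) * t * real p \<le> real q * log_max_modulus f (l * t)"
proof -
  have rewr: "max_modulus (exp s) f ^ q / exp s ^ p
    = exp (real q * log_max_modulus f s - real p * s)" for s
    by (simp add: exp_diff exp_of_nat_mult exp_log_max_modulus[OF f])
  have "max_modulus (exp t) f ^ q / exp t ^ p \<le> max_modulus (exp (l * t)) f ^ q / exp (l * t) ^ p"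
  proof (rule three_circles_power)
    have "max_modulus 1 f ^ q = exp (real q * log_max_modulus f 0)"
      using rewr[of 0] by simp
    then show "max_modulus 1 f ^ q < max_modulus (exp t) f ^ q / exp t ^ p"
      using slope unfolding rewr by (simp add: algebra_simps)
    show "exp t \<le> exp (l * t)"
      using assms mult_right_mono[of 1 l t] by simp
  qed (use assms in auto)
  then show ?thesis
    unfolding rewr by (simp add: algebra_simps)
qed

text \<open>Convexity alone gives exponent \<open>s = 1\<close>, log-regularity gives
  \<open>s = 1 + c\<close>. In the convex case the factor \<open>a\<close> absorbs the influence of
  the value at 0.\<close>

definition power_growth :: "real \<Rightarrow> (complex \<Rightarrow> complex) \<Rightarrow> bool" where
  "power_growth s f \<longleftrightarrow> (\<exists>a>0. \<exists>T>0. \<forall>t\<ge>T. log_max_modulus f t > 0 \<and>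
     (\<forall>l\<ge>1. log_max_modulus f (l * t) \<ge> a * l powr s * log_max_modulus f t))"

text \<open>Once \<open>\<phi> t\<close> exceeds twice \<open>\<bar>\<phi> 0\<bar>\<close>, the
  chord over [0, t] has slope above \<open>\<phi> t / (2 * t)\<close>. A rational slope
  \<open>x\<close> strictly between the two is admissible in the three circles estimate and yields
  \<open>\<phi> (l * t) \<ge> \<phi> t + (l - 1) * \<phi> t / 2\<close>, which is at least
  \<open>l * \<phi> t / 2\<close>.\<close>

lemma power_growth_nonconstant:
  assumes f: "entire f" "\<not> f constant_on UNIV"
  shows "power_growth 1 f"
proof -
  define \<phi> where "\<phi> = log_max_modulus f"
  have "\<forall>\<^sub>F t in at_top. \<phi> t \<ge> 4 * \<bar>\<phi> 0\<bar> + 1"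
    using log_max_modulus_at_top[OF f] unfolding \<phi>_def filterlim_at_top by blast
  then obtain T where T: "\<And>t. t \<ge> T \<Longrightarrow> \<phi> t \<ge> 4 * \<bar>\<phi> 0\<bar> + 1"
    by (auto simp: eventually_at_top_linorder)
  have "\<phi> (l * t) \<ge> (1/2) * l * \<phi> t" if t: "t \<ge> max T 1" and l: "l \<ge> 1" for t l
  proof -
    have pos: "\<phi> t > 0" "t > 0"
      using T[of t] t by auto
    have "\<phi> t / (2 * t) < (\<phi> t - \<phi> 0) / t"
      using T[of t] t pos by (simp add: field_simps)
    then obtain x where x: "x \<in> \<rat>" "\<phi> t / (2 * t) < x" "x < (\<phi> t - \<phi> 0) / t"
      using Rats_dense_in_real by blast
    have "x > 0"
      using x(2) pos by (smt (verit) divide_pos_pos)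
    then obtain p q :: nat where pq: "q > 0" "x = real p / real q"
      using x(1) Rats_abs_nat_div_natE[of x] by (metis abs_of_pos not_gr_zero)
    have p: "real p = real q * x"
      using pq by simp
    have "real p * t < real q * (\<phi> t - \<phi> 0)"
      using x(3) pq pos by (simp add: field_simps)
    then have "real q * \<phi> t + (l - 1) * t * real p \<le> real q * \<phi> (l * t)"
      using log_max_modulus_three_circles[OF f, of t l q p] pq pos l by (simp add: \<phi>_def)
    then have "real q * (\<phi> t + (l - 1) * (t * x)) \<le> real q * \<phi> (l * t)"
      unfolding p by (simp add: algebra_simps)
    then have "\<phi> t + (l - 1) * (t * x) \<le> \<phi> (l * t)"
      using pq(1) by simp
    moreover have "(l - 1) * \<phi> t \<le> (l - 1) * (2 * (t * x))"
      using x(2) pos l by (intro mult_left_mono) (auto simp: field_simps)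
    ultimately show ?thesis
      using pos by (simp add: algebra_simps)
  qed
  moreover have "\<phi> t > 0" if "t \<ge> max T 1" for t
    using T[of t] that by simp
  ultimately show ?thesis
    unfolding power_growth_def \<phi>_def[symmetric]
    by (intro exI[of _ "1/2"] conjI exI[of _ "max T 1"]) auto
qed

text \<open>The hypothesis \<open>left\<close> only excludes downward jumps from the left, so \<^term>\<open>F\<close> need not be
  assumed continuous.\<close>

lemma right_derivative_nonneg_imp_le:
  fixes F :: "real \<Rightarrow> real"
  assumes "a \<le> b"
    and deriv: "\<And>t. \<lbrakk>a \<le> t; t < b\<rbrakk> \<Longrightarrow> \<exists>D\<ge>0. (F has_real_derivative D) (at_right t)"
    and left: "\<And>t e. \<lbrakk>a < t; t \<le> b; e > 0\<rbrakk> \<Longrightarrow> \<forall>\<^sub>F s in at_left t. F s \<le> F t + e"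
  shows "F a \<le> F b"
proof -
  \<comment> \<open>Tilting \<open>F\<close> by the slope \<open>e\<close> leaves room for a
    continuation argument: the supremum \<open>u\<close> of the good points is good by
    \<open>left\<close>, and if \<open>u < b\<close>, the right difference quotients above
    \<open>- e\<close> would give a good point beyond \<open>u\<close>.\<close>
  have key: "F a \<le> F b + e * (b - a)" if e: "e > 0" for e
  proof -
    define S where "S = {t \<in> {a..b}. F a \<le> F t + e * (t - a)}"
    define u where "u = Sup S"
    have aS: "a \<in> S"
      using \<open>a \<le> b\<close> by (simp add: S_def)
    have bdd: "bdd_above S"
      unfolding S_def by (auto intro!: bdd_aboveI[of _ b])
    have u: "a \<le> u" "u \<le> b"
      using cSup_upper[OF aS bdd] aS by (auto simp: u_def S_def intro!: cSup_least)
    have uS: "u \<in> S"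
    proof (rule ccontr)
      assume not: "u \<notin> S"
      with aS u have "a < u"
        by (cases "a = u") auto
      define X where "X = e * (u - a)"
      \<comment> \<open>Half of the amount by which \<open>u\<close> would fail to be good; a good
        point just left of \<open>u\<close> leaves a failure of at most \<open>d\<close>, a
        contradiction.\<close>
      define d where "d = (F a - F u - X) / 2"
      have "d > 0"
        using not u by (simp add: S_def d_def X_def)
      have "\<forall>\<^sub>F s in at_left u. F s \<le> F u + d"
        using left[of u d] \<open>a < u\<close> u \<open>d > 0\<close> by auto
      then obtain c where c: "c < u" "\<And>s. \<lbrakk>c < s; s < u\<rbrakk> \<Longrightarrow> F s \<le> F u + d"
        unfolding eventually_at_left_field by blast
      obtain s where s: "s \<in> S" "c < s"
        using c(1) less_cSup_iff[of S c] aS bdd by (auto simp: u_def)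
      have "s \<noteq> u" "s \<le> u"
        using s not cSup_upper[OF s(1) bdd] by (auto simp: u_def)
      then have "F s \<le> F u + d"
        using c(2) s by simp
      moreover have "F a \<le> F s + e * (s - a)"
        using s by (simp add: S_def)
      moreover have "e * (s - a) \<le> X"
        using \<open>s \<le> u\<close> e by (simp add: X_def)
      ultimately have "F a \<le> F u + d + X"
        by linarith
      moreover have "2 * d = F a - F u - X"
        by (simp add: d_def)
      ultimately show False
        using \<open>d > 0\<close> by linarith
    qed
    have "u = b"
    proof (rule ccontr)
      assume "u \<noteq> b"
      with u have "u < b" by simp
      then obtain D where D: "D \<ge> 0" "(F has_real_derivative D) (at_right u)"
        using deriv u by blast
      then have "((\<lambda>t. (F t - F u) / (t - u)) \<longlongrightarrow> D) (at_right u)"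
        by (simp add: has_field_derivative_iff)
      then have "\<forall>\<^sub>F t in at_right u. (F t - F u) / (t - u) > - e"
        using D e by (intro order_tendstoD(1)) auto
      then obtain c where c: "c > u" "\<And>t. \<lbrakk>u < t; t < c\<rbrakk> \<Longrightarrow> (F t - F u) / (t - u) > - e"
        unfolding eventually_at_right_field by blast
      define t where "t = min ((u + c) / 2) b"
      have t: "u < t" "t < c" "t \<le> b"
        using c(1) \<open>u < b\<close> by (auto simp: t_def min_def)
      have "F t - F u > - e * (t - u)"
        using c(2)[OF t(1,2)] t(1) by (simp add: field_simps)
      then have "t \<in> S"
        using uS t u by (auto simp: S_def algebra_simps)
      then show False
        using cSup_upper[OF _ bdd] t(1) by (force simp: u_def)
    qed
    with uS show ?thesis by (simp add: S_def)
  qed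
  show ?thesis
  proof (cases "a = b")
    case False
    with \<open>a \<le> b\<close> have "a < b" by simp
    show ?thesis
    proof (rule field_le_epsilon)
      fix e :: real assume "e > 0"
      then show "F a \<le> F b + e"
        using key[of "e / (b - a)"] \<open>a < b\<close> by simp
    qed
  qed simp
qed

text \<open>Log-regularity says that the quotient \<open>F\<close> of \<open>\<phi> t\<close> by
  \<open>t powr (1 + c)\<close> has nonnegative right derivative, since this derivative is
  \<open>F t\<close> times \<open>D / \<phi> t - (1 + c) / t\<close>. So \<open>F\<close> is
  nondecreasing, and comparing it at \<open>t\<close> and \<open>l * t\<close> gives the growth with
  \<open>a = 1\<close>.\<close>

lemma power_growth_log_regular:
  assumes f: "entire f" "\<not> f constant_on UNIV" and "log_regular_with c f"
  shows "power_growth (1 + c) f"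
proof -
  define \<phi> where "\<phi> = log_max_modulus f"
  have "\<forall>\<^sub>F t in at_top. \<exists>D. (\<phi> has_real_derivative D) (at_right t) \<and> D / \<phi> t \<ge> (1 + c) / t"
    using assms(3) by (simp add: log_regular_with_def Let_def \<phi>_def log_max_modulus_def[abs_def])
  moreover have "\<forall>\<^sub>F t in at_top. \<phi> t > 0"
    using log_max_modulus_at_top[OF f] unfolding \<phi>_def filterlim_at_top_dense by blast
  ultimately have "\<forall>\<^sub>F t in at_top. \<phi> t > 0 \<and>
      (\<exists>D. (\<phi> has_real_derivative D) (at_right t) \<and> D / \<phi> t \<ge> (1 + c) / t)"
    by eventually_elim auto
  then obtain T where T: "\<And>t. t \<ge> T \<Longrightarrow> \<phi> t > 0"
    "\<And>t. t \<ge> T \<Longrightarrow> \<exists>D. (\<phi> has_real_derivative D) (at_right t) \<and> D / \<phi> t \<ge> (1 + c) / t"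
    by (auto simp: eventually_at_top_linorder)
  define F where "F = (\<lambda>t. \<phi> t * t powr - (1 + c))"
  have F: "F a \<le> F b" if a: "a \<ge> max T 1" and "a \<le> b" for a b
  proof (rule right_derivative_nonneg_imp_le[OF \<open>a \<le> b\<close>])
    fix t assume t: "a \<le> t" "t < b"
    then have pos: "t > 0" "\<phi> t > 0"
      using a T(1)[of t] by auto
    obtain D where D: "(\<phi> has_real_derivative D) (at_right t)" "D / \<phi> t \<ge> (1 + c) / t"
      using T(2)[of t] t a by auto
    have "((\<lambda>t. t powr - (1 + c)) has_real_derivative - (1 + c) * t powr (- (1 + c) - 1)) (at_right t)"
      using has_real_derivative_powr[OF pos(1)] has_field_derivative_at_within by blast
    from DERIV_mult[OF D(1) this]
    have "(F has_real_derivative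
        D * t powr - (1 + c) + (- (1 + c) * t powr (- (1 + c) - 1)) * \<phi> t) (at_right t)"
      by (simp add: F_def)
    also have "D * t powr - (1 + c) + (- (1 + c) * t powr (- (1 + c) - 1)) * \<phi> t
        = (D / \<phi> t - (1 + c) / t) * \<phi> t * t powr - (1 + c)"
    proof -
      have "t powr (- (1 + c) - 1) = t powr - (1 + c) / t"
        using powr_diff[of t "- (1 + c)" 1] pos by simp
      then show ?thesis
        unfolding \<open>t powr (- (1 + c) - 1) = _\<close> using pos
        by (simp add: divide_simps) (simp add: algebra_simps)
    qed
    finally show "\<exists>D\<ge>0. (F has_real_derivative D) (at_right t)"
      using D(2) pos by (meson diff_ge_0_iff_ge less_imp_le mult_nonneg_nonneg powr_ge_zero)
  next
    fix t e :: real assume t: "a < t" "t \<le> b" and "e > 0"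
    then have "t > 0"
      using a by auto
    \<comment> \<open>As \<open>\<phi>\<close> is nondecreasing, this function bounds
      \<open>F s\<close> from above for \<open>s < t\<close>, so its limit rules out a downward jump
      of \<open>F\<close> at \<open>t\<close>.\<close>
    have "((\<lambda>s. \<phi> t * s powr - (1 + c)) \<longlongrightarrow> F t) (at_left t)"
      unfolding F_def using \<open>t > 0\<close> by (intro tendsto_intros) auto
    then have "\<forall>\<^sub>F s in at_left t. \<phi> t * s powr - (1 + c) < F t + e"
      using \<open>e > 0\<close> by (intro order_tendstoD(2)) auto
    moreover have "\<forall>\<^sub>F s in at_left t. s < t"
      by (simp add: eventually_at_filter)
    ultimately show "\<forall>\<^sub>F s in at_left t. F s \<le> F t + e"
    proof eventually_elim
      case (elim s)
      have "F s \<le> \<phi> t * s powr - (1 + c)"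
        unfolding F_def \<phi>_def using elim by (intro mult_right_mono log_max_modulus_mono f) auto
      with elim show ?case by simp
    qed
  qed
  have "\<phi> (l * t) \<ge> l powr (1 + c) * \<phi> t" if "t \<ge> max T 1" "l \<ge> 1" for t l
  proof -
    have "F t \<le> F (l * t)"
      using that mult_right_mono[of 1 l t] by (intro F) auto
    then have "\<phi> t \<le> \<phi> (l * t) * l powr - (1 + c)"
      using that by (simp add: F_def powr_mult flip: mult.assoc)
    then have "l powr (1 + c) * \<phi> t \<le> l powr (1 + c) * (\<phi> (l * t) * l powr - (1 + c))"
      by (intro mult_left_mono) auto
    also have "\<dots> = \<phi> (l * t)"
      using that by (simp add: powr_minus del: minus_add_distrib)
    finally show ?thesis .
  qed
  then show ?thesis
    unfolding power_growth_def \<phi>_def[symmetric] using T(1)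
    by (intro exI[of _ 1] conjI exI[of _ "max T 1"]) auto
qed

section \<open>Stretching of connected sets\<close>

text \<open>The exponents \<open>s\<close> multiply under composition, so a single factor with \<open>s > 1\<close> makes \<open>\<kappa>\<close> grow
  under iteration whatever the constants \<open>a\<close> are.\<close>

definition stretches :: "real \<Rightarrow> (complex \<Rightarrow> complex) \<Rightarrow> bool" where
  "stretches s h \<longleftrightarrow> (\<exists>\<Phi> a T. a > 0 \<and> T > 0 \<and> (\<forall>t\<ge>T. \<Phi> t \<ge> a * t powr s \<and>
     (\<forall>\<kappa>\<ge>T. \<forall>\<Gamma>. connected \<Gamma> \<and> (\<exists>p\<in>\<Gamma>. norm p \<le> exp t) \<and> (\<exists>q\<in>\<Gamma>. norm q \<ge> exp (\<kappa> * t)) \<longrightarrow>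
       (\<exists>p\<in>\<Gamma>. norm (h p) \<le> exp (\<Phi> t)) \<and>
       (\<exists>q\<in>\<Gamma>. norm (h q) \<ge> exp (a * \<kappa> powr s * \<Phi> t)))))"

lemma stretchesE:
  assumes "stretches s h"
  obtains \<Phi> a T where "a > 0" "T > 0" "\<And>t. t \<ge> T \<Longrightarrow> \<Phi> t \<ge> a * t powr s"
    "\<And>t \<kappa> \<Gamma> p q. \<lbrakk>t \<ge> T; \<kappa> \<ge> T; connected \<Gamma>; p \<in> \<Gamma>; norm p \<le> exp t; q \<in> \<Gamma>;
      norm q \<ge> exp (\<kappa> * t)\<rbrakk> \<Longrightarrow> (\<exists>p\<in>\<Gamma>. norm (h p) \<le> exp (\<Phi> t)) \<and>
       (\<exists>q\<in>\<Gamma>. norm (h q) \<ge> exp (a * \<kappa> powr s * \<Phi> t))"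
proof -
  from assms obtain \<Phi> a T where "a > 0" "T > 0" and *: "\<forall>t\<ge>T. \<Phi> t \<ge> a * t powr s \<and>
     (\<forall>\<kappa>\<ge>T. \<forall>\<Gamma>. connected \<Gamma> \<and> (\<exists>p\<in>\<Gamma>. norm p \<le> exp t) \<and> (\<exists>q\<in>\<Gamma>. norm q \<ge> exp (\<kappa> * t)) \<longrightarrow>
       (\<exists>p\<in>\<Gamma>. norm (h p) \<le> exp (\<Phi> t)) \<and>
       (\<exists>q\<in>\<Gamma>. norm (h q) \<ge> exp (a * \<kappa> powr s * \<Phi> t)))"
    unfolding stretches_def by blast
  show ?thesis
    by (rule that[of a T \<Phi>]) (use \<open>a > 0\<close> \<open>T > 0\<close> * in blast)+
qed

text \<open>Here \<open>\<Phi>\<close> is \<open>log_max_modulus f\<close>. The point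
  \<open>p\<close> serves for the upper bound by the maximum principle, and a crossing of the
  boundary of an annular domain gives the lower bound.\<close>

lemma stretches_annular_domain:
  assumes f: "entire f" "\<not> f constant_on UNIV" and "m > 1" "annular_domain_property m f"
    and "s \<ge> 1" "power_growth s f"
  shows "stretches s f"
proof -
  define \<phi> where "\<phi> = log_max_modulus f"
  obtain a T where aT: "a > 0" "T > 0" "\<And>t. t \<ge> T \<Longrightarrow> \<phi> t > 0"
    "\<And>t l. \<lbrakk>t \<ge> T; l \<ge> 1\<rbrakk> \<Longrightarrow> \<phi> (l * t) \<ge> a * l powr s * \<phi> t"
    using assms(6) unfolding power_growth_def \<phi>_def by metis
  obtain R where R: "R > 0" "\<And>r. r \<ge> R \<Longrightarrow> \<exists>G. ball 0 r \<subseteq> G \<and> G \<subseteq> ball 0 (r powr m) \<and>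
        (\<forall>z\<in>frontier G. norm (f z) \<ge> max_modulus r f)"
    using assms(4) unfolding annular_domain_property_def by meson
  \<comment> \<open>The first entry pays for replacing \<open>\<kappa>\<close> by
    \<open>\<kappa> / m\<close>; the second gives the lower bound on \<open>\<phi> t\<close> by
    comparison with \<open>\<phi> T\<close>. In \<open>T'\<close>, the term \<open>ln R\<close>
    makes annular domains available, and \<open>2 * m\<close> forces
    \<open>\<kappa> / m \<ge> 2\<close>.\<close>
  define b where "b = min (a / m powr s) (a * \<phi> T / T powr s)"
  define T' where "T' = max (max T (ln R)) (2 * m)"
  have "b > 0"
    using aT assms(3) by (simp add: b_def)
  moreover have "T' > 0"
    using assms(3) by (simp add: T'_def)
  moreover have "\<phi> t \<ge> b * t powr s" if t: "t \<ge> T'" for t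
  proof -
    have "b * t powr s \<le> (a * \<phi> T / T powr s) * t powr s"
      by (intro mult_right_mono) (auto simp: b_def)
    also have "\<dots> = a * (t / T) powr s * \<phi> T"
      using aT t by (simp add: powr_divide T'_def)
    also have "\<dots> \<le> \<phi> (t / T * T)"
      using aT(2) t by (intro aT(4)) (auto simp: T'_def)
    finally show ?thesis
      using aT(2) by simp
  qed
  moreover have "(\<exists>p\<in>\<Gamma>. norm (f p) \<le> exp (\<phi> t)) \<and>
      (\<exists>q\<in>\<Gamma>. norm (f q) \<ge> exp (b * \<kappa> powr s * \<phi> t))"
    if t: "t \<ge> T'" and \<kappa>: "\<kappa> \<ge> T'" and \<Gamma>: "connected \<Gamma>"
      and p: "p \<in> \<Gamma>" "norm p \<le> exp t" and q: "q \<in> \<Gamma>" "norm q \<ge> exp (\<kappa> * t)" for t \<kappa> \<Gamma> p q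
  proof
    have "norm (f p) \<le> exp (\<phi> t)"
      unfolding \<phi>_def exp_log_max_modulus[OF f] by (rule norm_le_max_modulus[OF f(1) p(2)])
    with p(1) show "\<exists>p\<in>\<Gamma>. norm (f p) \<le> exp (\<phi> t)"
      by blast
    \<comment> \<open>Chosen so that \<open>exp u powr m = exp (\<kappa> * t)\<close>: the domain
      \<open>G\<close> for radius \<open>exp u\<close> contains \<open>p\<close>, because
      \<open>u > t\<close>, but not \<open>q\<close>.\<close>
    define u where "u = \<kappa> / m * t"
    have "t > 0" "t \<ge> T" "\<phi> t > 0"
      using t aT by (auto simp: T'_def)
    have "\<kappa> / m \<ge> 2"
      using \<kappa> assms(3) by (simp add: T'_def field_simps)
    then have "u \<ge> 2 * t"
      unfolding u_def using \<open>t > 0\<close> by (intro mult_right_mono) auto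
    then have "u > t"
      using \<open>t > 0\<close> by simp
    have "ln R \<le> u"
      using t \<open>u > t\<close> by (simp add: T'_def)
    then have "R \<le> exp u"
      using R(1) by (metis exp_le_cancel_iff exp_ln)
    then obtain G where G: "ball 0 (exp u) \<subseteq> G" "G \<subseteq> ball 0 (exp u powr m)"
        "\<And>z. z \<in> frontier G \<Longrightarrow> norm (f z) \<ge> max_modulus (exp u) f"
      using R(2)[OF \<open>R \<le> exp u\<close>] by blast
    have "norm p < exp u"
      using p(2) \<open>u > t\<close> by (smt (verit) exp_less_mono)
    then have "p \<in> G"
      using G(1) by auto
    have "exp u powr m = exp (\<kappa> * t)"
      using assms(3) by (simp add: u_def powr_def)
    then have "q \<notin> G"
      using q(2) G(2) by force
    then obtain z where z: "z \<in> \<Gamma>" "z \<in> frontier G"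
      using connected_Int_frontier[OF \<Gamma>, of G] p(1) q(1) \<open>p \<in> G\<close> by blast
    have "b * \<kappa> powr s * \<phi> t \<le> a / m powr s * \<kappa> powr s * \<phi> t"
      using \<open>\<phi> t > 0\<close> by (intro mult_right_mono) (auto simp: b_def)
    also have "\<dots> = a * (\<kappa> / m) powr s * \<phi> t"
      using \<kappa> assms(3) by (simp add: powr_divide T'_def)
    also have "\<dots> \<le> \<phi> u"
      unfolding u_def using \<open>\<kappa> / m \<ge> 2\<close> \<open>t \<ge> T\<close> by (intro aT(4)) auto
    finally have "exp (b * \<kappa> powr s * \<phi> t) \<le> exp (\<phi> u)"
      by simp
    also have "\<dots> \<le> norm (f z)"
      unfolding \<phi>_def exp_log_max_modulus[OF f] by (rule G(3)[OF z(2)])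
    finally show "\<exists>q\<in>\<Gamma>. norm (f q) \<ge> exp (b * \<kappa> powr s * \<phi> t)"
      using z(1) by blast
  qed
  ultimately show ?thesis
    unfolding stretches_def by (intro exI[of _ \<phi>] exI[of _ b] exI[of _ T']) blast
qed

section \<open>Composition and iteration of stretching maps\<close>

lemma eventually_mult_powr_ge:
  fixes a s B :: real
  assumes "a > 0" "s > 0"
  obtains T where "T > 0" "\<And>t. t \<ge> T \<Longrightarrow> a * t powr s \<ge> B"
proof -
  define T where "T = max 1 (B / a) powr (1 / s)"
  have "a * t powr s \<ge> B" if "t \<ge> T" for t
  proof -
    have "B / a \<le> T powr s"
      using assms by (simp add: T_def powr_powr)
    also have "\<dots> \<le> t powr s"
      using assms that by (intro powr_mono2) (auto simp: T_def)
    finally show ?thesis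
      using assms by (simp add: field_simps)
  qed
  moreover have "T > 0"
    by (simp add: T_def)
  ultimately show ?thesis
    by (rule that[rotated])
qed

lemma stretches_comp:
  assumes "stretches s h" "stretches s' h'" "s \<ge> 1" "s' \<ge> 1" "continuous_on UNIV h'"
  shows "stretches (s * s') (h \<circ> h')"
proof -
  obtain \<Phi> a T where 1: "a > 0" "T > 0" "\<And>t. t \<ge> T \<Longrightarrow> \<Phi> t \<ge> a * t powr s"
    "\<And>t \<kappa> \<Gamma> p q. \<lbrakk>t \<ge> T; \<kappa> \<ge> T; connected \<Gamma>; p \<in> \<Gamma>; norm p \<le> exp t; q \<in> \<Gamma>;
      norm q \<ge> exp (\<kappa> * t)\<rbrakk> \<Longrightarrow> (\<exists>p\<in>\<Gamma>. norm (h p) \<le> exp (\<Phi> t)) \<and>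
       (\<exists>q\<in>\<Gamma>. norm (h q) \<ge> exp (a * \<kappa> powr s * \<Phi> t))"
    using assms(1) by (rule stretchesE) (rule that; blast)
  obtain \<Phi>' a' T' where 2: "a' > 0" "T' > 0" "\<And>t. t \<ge> T' \<Longrightarrow> \<Phi>' t \<ge> a' * t powr s'"
    "\<And>t \<kappa> \<Gamma> p q. \<lbrakk>t \<ge> T'; \<kappa> \<ge> T'; connected \<Gamma>; p \<in> \<Gamma>; norm p \<le> exp t; q \<in> \<Gamma>;
      norm q \<ge> exp (\<kappa> * t)\<rbrakk> \<Longrightarrow> (\<exists>p\<in>\<Gamma>. norm (h' p) \<le> exp (\<Phi>' t)) \<and>
       (\<exists>q\<in>\<Gamma>. norm (h' q) \<ge> exp (a' * \<kappa> powr s' * \<Phi>' t))"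
    using assms(2) by (rule stretchesE) (rule that; blast)
  obtain T0 where T0: "T0 > 0" "\<And>t. t \<ge> T0 \<Longrightarrow> a' * t powr s' \<ge> T"
    by (rule eventually_mult_powr_ge[of a' s' T]) (use assms(4) 2(1) in auto)
  \<comment> \<open>Inserting \<open>a' * x powr s'\<close> into \<open>a * y powr s\<close>
    produces exactly this constant; it serves both for \<open>x = t\<close> and for
    \<open>x = \<kappa>\<close>.\<close>
  define b where "b = a * a' powr s"
  have b: "b * x powr (s * s') = a * (a' * x powr s') powr s" if "x > 0" for x
    using that 2(1) by (simp add: b_def powr_mult powr_powr mult.commute)
  have "b > 0"
    using 1(1) 2(1) by (simp add: b_def)
  moreover have "max T0 T' > 0"
    using T0 by simp
  moreover have "\<Phi> (\<Phi>' t) \<ge> b * t powr (s * s')" if "t \<ge> max T0 T'" for t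
  proof -
    have "\<Phi>' t \<ge> a' * t powr s'" "a' * t powr s' \<ge> T"
      using that T0 2 by auto
    then have "(a' * t powr s') powr s \<le> \<Phi>' t powr s" "\<Phi>' t \<ge> T"
      using assms(3) 1(2) by (auto intro!: powr_mono2)
    then have "a * (a' * t powr s') powr s \<le> \<Phi> (\<Phi>' t)"
      using 1(1,3) by (meson mult_left_mono less_imp_le order_trans)
    then show ?thesis
      using b[of t] that T0(1) by simp
  qed
  moreover have "(\<exists>p\<in>\<Gamma>. norm ((h \<circ> h') p) \<le> exp (\<Phi> (\<Phi>' t))) \<and>
      (\<exists>q\<in>\<Gamma>. norm ((h \<circ> h') q) \<ge> exp (b * \<kappa> powr (s * s') * \<Phi> (\<Phi>' t)))"
    if t: "t \<ge> max T0 T'" and \<kappa>: "\<kappa> \<ge> max T0 T'" and \<Gamma>: "connected \<Gamma>"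
      and p: "p \<in> \<Gamma>" "norm p \<le> exp t" and q: "q \<in> \<Gamma>" "norm q \<ge> exp (\<kappa> * t)" for t \<kappa> \<Gamma> p q
  proof -
    have "\<Phi>' t \<ge> T" "a' * \<kappa> powr s' \<ge> T"
      using T0(2) 2(3) t \<kappa> by (auto intro: order_trans)
    moreover have "connected (h' ` \<Gamma>)"
      using \<Gamma> assms(5) by (meson connected_continuous_image continuous_on_subset subset_UNIV)
    moreover obtain p' q' where "p' \<in> \<Gamma>" "norm (h' p') \<le> exp (\<Phi>' t)"
        "q' \<in> \<Gamma>" "norm (h' q') \<ge> exp (a' * \<kappa> powr s' * \<Phi>' t)"
      using 2(4)[OF _ _ \<Gamma> p q] t \<kappa> by auto
    ultimately show ?thesis
      using 1(4)[of "\<Phi>' t" "a' * \<kappa> powr s'" "h' ` \<Gamma>" "h' p'" "h' q'"] b[of \<kappa>] \<kappa> T0(1) by simp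
  qed
  ultimately show ?thesis
    unfolding stretches_def
    by (intro exI[of _ "\<lambda>t. \<Phi> (\<Phi>' t)"] exI[of _ b] exI[of _ "max T0 T'"]) blast
qed

lemma stretches_id: "stretches 1 id"
  unfolding stretches_def
  by (intro exI[of _ "\<lambda>t. t"] exI[of _ 1] exI[of _ 1]) auto

lemma foldr_comp_Cons: "foldr (\<circ>) (map f (j # js)) id = f j \<circ> foldr (\<circ>) (map f js) id"
  by simp

text \<open>Continuity and the bound on the product travel along in the induction because
  \<open>stretches_comp\<close> asks for them.\<close>

lemma stretches_foldr_comp:
  assumes "\<And>j. j \<in> set js \<Longrightarrow> continuous_on UNIV (f j) \<and> s j \<ge> 1 \<and> stretches (s j) (f j)"
  shows "continuous_on UNIV (foldr (\<circ>) (map f js) id) \<and> (\<Prod>j\<leftarrow>js. s j) \<ge> 1 \<and>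
    stretches (\<Prod>j\<leftarrow>js. s j) (foldr (\<circ>) (map f js) id)"
  using assms
proof (induction js)
  case Nil
  then show ?case using stretches_id by (simp add: id_def)
next
  case (Cons j js)
  define F where "F = foldr (\<circ>) (map f js) id"
  define P where "P = (\<Prod>j\<leftarrow>js. s j)"
  have "continuous_on UNIV F \<and> P \<ge> 1 \<and> stretches P F"
    unfolding F_def P_def using Cons.prems by (intro Cons.IH) simp
  moreover have "continuous_on UNIV (f j) \<and> s j \<ge> 1 \<and> stretches (s j) (f j)"
    using Cons.prems by simp
  ultimately have "continuous_on UNIV (f j \<circ> F) \<and> s j * P \<ge> 1 \<and> stretches (s j * P) (f j \<circ> F)"
    using mult_mono[of 1 "s j" 1 P]
    by (auto intro: stretches_comp continuous_on_compose2[of UNIV "f j" UNIV F])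
  then show ?case
    unfolding foldr_comp_Cons by (simp only: F_def P_def list.map prod_list.Cons)
qed

lemma prod_list_ge_member:
  fixes s :: "'a \<Rightarrow> real"
  assumes "\<And>i. i \<in> set js \<Longrightarrow> s i \<ge> 1" "j \<in> set js"
  shows "(\<Prod>i\<leftarrow>js. s i) \<ge> s j"
proof -
  have ge1: "(\<Prod>i\<leftarrow>xs. s i) \<ge> 1" if "\<And>i. i \<in> set xs \<Longrightarrow> s i \<ge> 1" for xs
    using that
  proof (induction xs)
    case (Cons x xs)
    then have "1 \<le> s x" "1 \<le> (\<Prod>i\<leftarrow>xs. s i)"
      by auto
    then have "1 * 1 \<le> s x * (\<Prod>i\<leftarrow>xs. s i)"
      by (intro mult_mono) auto
    then show ?case by simp
  qed simp
  obtain xs ys where js: "js = xs @ j # ys"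
    using assms(2) split_list by metis
  have "1 * (s j * 1) \<le> (\<Prod>i\<leftarrow>xs. s i) * (s j * (\<Prod>i\<leftarrow>ys. s i))"
    using assms(1) ge1[of xs] ge1[of ys] order_trans[OF zero_le_one] unfolding js
    by (intro mult_mono) auto
  then show ?thesis
    by (simp add: js)
qed

text \<open>Because \<open>s > 1\<close>, \<open>a * x powr s \<ge> 2 * x\<close> for all large
  \<open>x\<close>, so each application of \<open>h\<close> at least doubles both the scale
  \<open>u\<close> and the exponent. Applying \<open>h\<close> repeatedly to the images of
  \<open>\<Gamma>\<close>, instead of composing the stretching property with itself, gives one
  threshold \<open>T\<close> for all \<open>n\<close>.\<close>

lemma stretches_funpow:
  assumes "stretches s h" "s > 1" "continuous_on UNIV h"
  obtains T where "T > 0"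
    "\<And>t \<Gamma> n. \<lbrakk>t \<ge> T; connected \<Gamma>; \<exists>p\<in>\<Gamma>. norm p \<le> exp t; \<exists>q\<in>\<Gamma>. norm q \<ge> exp (T * t)\<rbrakk> \<Longrightarrow>
      \<exists>u\<ge>2 ^ n * T. \<exists>p\<in>\<Gamma>. \<exists>q\<in>\<Gamma>. norm ((h ^^ n) p) \<le> exp u \<and> norm ((h ^^ n) q) \<ge> exp (2 ^ n * T * u)"
proof -
  obtain \<Phi> a T where 1: "a > 0" "T > 0" "\<And>t. t \<ge> T \<Longrightarrow> \<Phi> t \<ge> a * t powr s"
    "\<And>t \<kappa> \<Gamma> p q. \<lbrakk>t \<ge> T; \<kappa> \<ge> T; connected \<Gamma>; p \<in> \<Gamma>; norm p \<le> exp t; q \<in> \<Gamma>;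
      norm q \<ge> exp (\<kappa> * t)\<rbrakk> \<Longrightarrow> (\<exists>p\<in>\<Gamma>. norm (h p) \<le> exp (\<Phi> t)) \<and>
       (\<exists>q\<in>\<Gamma>. norm (h q) \<ge> exp (a * \<kappa> powr s * \<Phi> t))"
    using assms(1) by (rule stretchesE) (rule that; blast)
  obtain T0 where T0: "T0 > 0" "\<And>t. t \<ge> T0 \<Longrightarrow> a * t powr (s - 1) \<ge> 2"
    by (rule eventually_mult_powr_ge[of a "s - 1" 2]) (use assms(2) 1(1) in auto)
  have double: "a * t powr s \<ge> 2 * t" if "t \<ge> T0" for t
  proof -
    have "2 * t \<le> a * t powr (s - 1) * t"
      using T0 that by (intro mult_right_mono) auto
    also have "\<dots> = a * t powr s"
      using T0(1) that by (simp add: powr_diff)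
    finally show ?thesis .
  qed
  define T1 where "T1 = max T T0"
  have T1: "2 ^ n * T1 \<ge> T1" for n :: nat
    using 1(2) mult_right_mono[of 1 "2 ^ n" T1] by (simp add: T1_def)
  have "\<exists>u\<ge>2 ^ n * T1. \<exists>p\<in>\<Gamma>. \<exists>q\<in>\<Gamma>. norm ((h ^^ n) p) \<le> exp u \<and>
      norm ((h ^^ n) q) \<ge> exp (2 ^ n * T1 * u)"
    if "t \<ge> T1" "connected \<Gamma>" "\<exists>p\<in>\<Gamma>. norm p \<le> exp t" "\<exists>q\<in>\<Gamma>. norm q \<ge> exp (T1 * t)" for t \<Gamma> n
  proof (induction n)
    case 0
    then show ?case using that by auto
  next
    case (Suc n)
    then obtain u p q where u: "u \<ge> 2 ^ n * T1" "p \<in> \<Gamma>" "q \<in> \<Gamma>"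
        "norm ((h ^^ n) p) \<le> exp u" "norm ((h ^^ n) q) \<ge> exp (2 ^ n * T1 * u)"
      by blast
    have "continuous_on UNIV (h ^^ n)"
      by (induction n) (auto intro!: continuous_on_compose2[OF assms(3)])
    then have "connected ((h ^^ n) ` \<Gamma>)"
      using that(2) by (meson connected_continuous_image continuous_on_subset subset_UNIV)
    moreover have ge: "u \<ge> T1" "2 ^ n * T1 \<ge> T1"
      using u(1) T1[of n] by auto
    ultimately obtain p' q' where p'q': "p' \<in> \<Gamma>" "norm (h ((h ^^ n) p')) \<le> exp (\<Phi> u)" "q' \<in> \<Gamma>"
        "norm (h ((h ^^ n) q')) \<ge> exp (a * (2 ^ n * T1) powr s * \<Phi> u)"
      using 1(4)[of u "2 ^ n * T1" "(h ^^ n) ` \<Gamma>" "(h ^^ n) p" "(h ^^ n) q"] u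
      by (auto simp: T1_def)
    have u': "\<Phi> u \<ge> 2 * u"
      using 1(3)[of u] double[of u] ge by (auto simp: T1_def)
    then have "\<Phi> u \<ge> 0"
      using ge(1) 1(2) by (auto simp: T1_def)
    then have "2 ^ Suc n * T1 * \<Phi> u \<le> a * (2 ^ n * T1) powr s * \<Phi> u"
      using double[of "2 ^ n * T1"] ge(2) by (intro mult_right_mono) (auto simp: T1_def)
    then have "exp (2 ^ Suc n * T1 * \<Phi> u) \<le> exp (a * (2 ^ n * T1) powr s * \<Phi> u)"
      by (simp only: exp_le_cancel_iff)
    also have "\<dots> \<le> norm ((h ^^ Suc n) q')"
      using p'q'(4) by simp
    finally have "norm ((h ^^ Suc n) q') \<ge> exp (2 ^ Suc n * T1 * \<Phi> u)" .
    moreover have "\<Phi> u \<ge> 2 ^ Suc n * T1"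
      using u' u(1) by simp
    ultimately show ?case
      using p'q' by (intro exI[of _ "\<Phi> u"]) auto
  qed
  moreover have "T1 > 0"
    using 1(2) by (simp add: T1_def)
  ultimately show ?thesis
    by (rule that[rotated])
qed

section \<open>Harnack estimates on the Fatou set\<close>

text \<open>Harnack's inequality for the positive harmonic function \<open>ln (norm (h z))\<close>
  at relative radius 1/2, where the constant is (1 + 1/2) / (1 - 1/2) = 3. It is derived from the
  Schwarz lemma for a holomorphic logarithm \<open>u\<close> of \<open>h\<close>, whose real part is
  positive.\<close>

lemma ln_norm_Harnack:
  assumes h: "h holomorphic_on ball w (2 * \<rho>)" and gt1: "\<And>z. z \<in> ball w (2 * \<rho>) \<Longrightarrow> norm (h z) > 1"
    and z: "z \<in> ball w \<rho>"
  shows "ln (norm (h z)) \<le> 3 * ln (norm (h w))"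
proof -
  have \<rho>: "\<rho> > 0"
    using z by (metis ball_eq_empty empty_iff not_le)
  have nz: "h x \<noteq> 0" if "x \<in> ball w (2 * \<rho>)" for x
    using gt1[OF that] by auto
  obtain u where u: "u holomorphic_on ball w (2 * \<rho>)" "\<And>x. x \<in> ball w (2 * \<rho>) \<Longrightarrow> exp (u x) = h x"
    using holomorphic_logarithm_exists[OF convex_ball open_ball h nz, of w] \<rho> by auto
  have Re_u: "Re (u x) = ln (norm (h x))" "Re (u x) > 0" if "x \<in> ball w (2 * \<rho>)" for x
  proof -
    have "norm (h x) = exp (Re (u x))"
      using u(2)[OF that] by (metis norm_exp_eq_Re)
    then show "Re (u x) = ln (norm (h x))" "Re (u x) > 0"
      using gt1[OF that] by auto
  qed
  define L where "L = (\<lambda>\<zeta>::complex. w + of_real (2 * \<rho>) * \<zeta>)"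
  \<comment> \<open>After \<open>L\<close> rescales the unit disc to the ball, a Cayley transform
    maps the right half-plane to the unit disc and sends \<open>u w\<close> to 0.\<close>
  define \<psi> where "\<psi> = (\<lambda>\<zeta>. (u (L \<zeta>) - u w) / (u (L \<zeta>) + cnj (u w)))"
  have L: "L \<zeta> \<in> ball w (2 * \<rho>)" if "norm \<zeta> < 1" for \<zeta>
    using that \<rho> by (simp add: L_def dist_norm norm_mult)
  have w: "w \<in> ball w (2 * \<rho>)"
    using \<rho> by simp
  have denom: "Re (u (L \<zeta>) + cnj (u w)) > 0" if "norm \<zeta> < 1" for \<zeta>
    using Re_u(2)[OF L[OF that]] Re_u(2)[OF w] by simp
  have denom_nz: "u (L \<zeta>) + cnj (u w) \<noteq> 0" if "norm \<zeta> < 1" for \<zeta>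
    using denom[OF that] by (metis less_irrefl zero_complex.sel(1))
  have holo: "\<psi> holomorphic_on ball 0 1"
  proof -
    have "(u \<circ> L) holomorphic_on ball 0 1"
      using L by (intro holomorphic_on_compose_gen[OF _ u(1)]) (auto simp: L_def intro!: holomorphic_intros)
    then show ?thesis
      unfolding \<psi>_def using denom_nz by (intro holomorphic_intros) (auto simp: o_def)
  qed
  have "norm (\<psi> \<zeta>) < 1" if "norm \<zeta> < 1" for \<zeta>
  proof -
    define a b where "a = u (L \<zeta>)" and "b = u w"
    have "Re a * Re b > 0"
      using Re_u(2)[OF L[OF that]] Re_u(2)[OF w] by (simp add: a_def b_def)
    \<comment> \<open>The difference of the two squares is \<open>4 * Re a * Re b\<close>.\<close>
    then have "norm (a - b) ^ 2 < norm (a + cnj b) ^ 2"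
      unfolding cmod_power2 by (simp add: power2_eq_square algebra_simps)
    then have "norm (a - b) < norm (a + cnj b)"
      using power_less_imp_less_base norm_ge_zero by blast
    then show ?thesis
      using norm_ge_zero[of "a - b"] le_less_trans
      by (fastforce simp: \<psi>_def norm_divide divide_less_eq_1 simp flip: a_def b_def)
  qed
  moreover have "\<psi> 0 = 0"
    by (simp add: \<psi>_def L_def)
  moreover define \<zeta> where "\<zeta> = (z - w) / of_real (2 * \<rho>)"
  have \<zeta>: "norm \<zeta> < 1 / 2"
    using z \<rho> by (simp add: \<zeta>_def norm_divide dist_norm norm_minus_commute)
  ultimately have "norm (\<psi> \<zeta>) \<le> norm \<zeta>"
    using Schwarz_Lemma(1)[OF holo] by simp
  moreover have "L \<zeta> = z"
    using \<rho> by (simp add: L_def \<zeta>_def)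
  ultimately have "norm (u z - u w) \<le> norm \<zeta> * norm (u z + cnj (u w))"
    using \<zeta> denom_nz[of \<zeta>] by (simp add: \<psi>_def norm_divide divide_simps)
  also have "\<dots> \<le> 1 / 2 * norm (u z + cnj (u w))"
    using \<zeta> by (intro mult_right_mono) auto
  finally have "norm (u z - u w) \<le> 1 / 2 * norm (u z + cnj (u w))" .
  \<comment> \<open>Both sides involve the same difference of imaginary parts, so discarding it
    leaves twice the distance of the real parts bounded by their sum, which is the factor 3.\<close>
  then have "norm (u z - u w) ^ 2 \<le> (1 / 2 * norm (u z + cnj (u w))) ^ 2"
    by (intro power_mono) auto
  then have "4 * (Re (u z) - Re (u w))\<^sup>2 + 3 * (Im (u z) - Im (u w))\<^sup>2 \<le> (Re (u z) + Re (u w))\<^sup>2"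
    by (simp add: power_mult_distrib cmod_power2 power_divide)
  moreover have "(2 * (Re (u z) - Re (u w)))\<^sup>2
      \<le> 4 * (Re (u z) - Re (u w))\<^sup>2 + 3 * (Im (u z) - Im (u w))\<^sup>2"
    unfolding power_mult_distrib by simp
  ultimately have "(2 * (Re (u z) - Re (u w)))\<^sup>2 \<le> (Re (u z) + Re (u w))\<^sup>2"
    by (rule order_trans[rotated])
  then have "\<bar>2 * (Re (u z) - Re (u w))\<bar> \<le> \<bar>Re (u z) + Re (u w)\<bar>"
    by (simp only: abs_le_square_iff)
  moreover have "z \<in> ball w (2 * \<rho>)"
    using z \<rho> by simp
  ultimately show ?thesis
    using Re_u[of z] Re_u[OF w] by simp
qed

text \<open>By normality, every subsequence has a further one that converges or diverges on all of
  \<open>S\<close>, and the behaviour at \<open>z\<close> excludes convergence.\<close>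

lemma normal_family_diverges:
  assumes "normal_family \<F> S" "range h \<subseteq> \<F>" "z \<in> S"
    and z: "filterlim (\<lambda>n. norm (h n z)) at_top sequentially"
    and "compact K" "K \<subseteq> S"
  shows "\<forall>\<^sub>F n in sequentially. \<forall>w\<in>K. B \<le> norm (h n w)"
proof (rule ccontr)
  assume "\<not> ?thesis"
  then have "infinite {n. \<not> (\<forall>w\<in>K. B \<le> norm (h n w))}"
    by (simp only: eventually_cofinite flip: cofinite_eq_sequentially) simp
  from infinite_enumerate[OF this]
  obtain \<tau> :: "nat \<Rightarrow> nat" where \<tau>: "strict_mono \<tau>" "\<And>n. \<not> (\<forall>w\<in>K. B \<le> norm (h (\<tau> n) w))"
    by (auto simp only: mem_Collect_eq)
  have "range (\<lambda>n. h (\<tau> n)) \<subseteq> \<F>"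
    using assms(2) by auto
  then obtain \<sigma> :: "nat \<Rightarrow> nat" where \<sigma>: "strict_mono \<sigma>"
    "(\<exists>g. \<forall>K. compact K \<and> K \<subseteq> S \<longrightarrow> uniform_limit K (\<lambda>n. h (\<tau> (\<sigma> n))) g sequentially) \<or>
     (\<forall>K. compact K \<and> K \<subseteq> S \<longrightarrow> (\<forall>B. \<forall>\<^sub>F n in sequentially. \<forall>z\<in>K. B \<le> norm (h (\<tau> (\<sigma> n)) z)))"
    using assms(1) unfolding normal_family_def by blast
  from \<sigma>(2) show False
  proof
    assume "\<exists>g. \<forall>K. compact K \<and> K \<subseteq> S \<longrightarrow> uniform_limit K (\<lambda>n. h (\<tau> (\<sigma> n))) g sequentially"
    then obtain g where g: "uniform_limit {z} (\<lambda>n. h (\<tau> (\<sigma> n))) g sequentially"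
      using assms(3) by (metis compact_sing empty_subsetI insert_subset)
    have "(\<lambda>n. norm (h (\<tau> (\<sigma> n)) z)) \<longlonglongrightarrow> norm (g z)"
      by (intro tendsto_norm tendsto_uniform_limitI[OF g]) simp
    moreover have "strict_mono (\<tau> \<circ> \<sigma>)"
      using \<tau>(1) \<sigma>(1) by (rule strict_mono_o)
    then have "filterlim (\<lambda>n. norm (h (\<tau> (\<sigma> n)) z)) at_top sequentially"
      using filterlim_compose[OF z filterlim_subseq] by (simp add: o_def)
    ultimately show False
      using not_tendsto_and_filterlim_at_infinity[OF sequentially_bot]
        filterlim_at_top_imp_at_infinity by blast
  next
    assume "\<forall>K. compact K \<and> K \<subseteq> S \<longrightarrow>
      (\<forall>B. \<forall>\<^sub>F n in sequentially. \<forall>z\<in>K. B \<le> norm (h (\<tau> (\<sigma> n)) z))"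
    then have "\<forall>\<^sub>F n in sequentially. \<forall>z\<in>K. B \<le> norm (h (\<tau> (\<sigma> n)) z)"
      using assms(5,6) by blast
    then show False
      using \<tau>(2) by simp
  qed
qed

section \<open>Iterates along compact connected subsets of the Fatou set\<close>

lemma entire_funpow:
  assumes "entire g"
  shows "entire (g ^^ n)"
proof (induction n)
  case (Suc n)
  show ?case
    using holomorphic_on_compose_gen[OF Suc assms] by (simp add: o_def)
qed (simp add: holomorphic_on_id)

lemma open_fatou_set: "open (fatou_set g)"
proof -
  have "fatou_set g = \<Union>{U. open U \<and> connected U \<and> normal_family {g ^^ n |n. n \<ge> 1} U}"
    unfolding fatou_set_def by blast
  then show ?thesis by auto
qed

text \<open>The points \<open>q n\<close> move, so first a subsequence of them converges to some
  \<open>q'\<close>. A finite uniform limit on a disc about \<open>q'\<close> would be bounded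
  there, against \<open>div\<close>; hence the iterates diverge at \<open>q'\<close>, and divergence
  spreads over the connected set.\<close>

lemma fatou_set_diverging_subsequence:
  assumes g: "entire g" and "compact \<Gamma>" "connected \<Gamma>" "\<Gamma> \<subseteq> fatou_set g"
    and q: "\<And>n. q n \<in> \<Gamma>" and div: "filterlim (\<lambda>n. norm ((g ^^ n) (q n))) at_top sequentially"
  obtains \<sigma> :: "nat \<Rightarrow> nat" where "strict_mono \<sigma>" "\<And>n. \<sigma> n \<ge> 1"
    "\<And>z. z \<in> \<Gamma> \<Longrightarrow> filterlim (\<lambda>n. norm ((g ^^ \<sigma> n) z)) at_top sequentially"
proof -
  obtain q' \<sigma> where q': "q' \<in> \<Gamma>" and \<sigma>: "strict_mono \<sigma>" "(q \<circ> \<sigma>) \<longlonglongrightarrow> q'"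
    using assms(2) q unfolding compact_def by blast
  obtain V where V: "open V" "q' \<in> V" "normal_family {g ^^ n |n. n \<ge> 1} V"
    using q' assms(4) unfolding fatou_set_def by blast
  obtain r where r: "r > 0" "cball q' r \<subseteq> V"
    using V(1,2) open_contains_cball by blast
  \<comment> \<open>The family in \<open>fatou_set\<close> starts with the first iterate, while
    \<open>\<sigma> 0\<close> may be 0; the shift by \<open>Suc\<close> skips that term.\<close>
  have ge1: "\<sigma> (Suc n) \<ge> 1" for n
    using strict_mono_imp_increasing[OF \<sigma>(1), of "Suc n"] by simp
  then have "range (\<lambda>n. g ^^ \<sigma> (Suc n)) \<subseteq> {g ^^ n |n. n \<ge> 1}"
    by auto
  then obtain \<tau> :: "nat \<Rightarrow> nat" where \<tau>: "strict_mono \<tau>"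
    "(\<exists>G. \<forall>K. compact K \<and> K \<subseteq> V \<longrightarrow> uniform_limit K (\<lambda>n. g ^^ \<sigma> (Suc (\<tau> n))) G sequentially) \<or>
     (\<forall>K. compact K \<and> K \<subseteq> V \<longrightarrow> (\<forall>B. \<forall>\<^sub>F n in sequentially. \<forall>z\<in>K. B \<le> norm ((g ^^ \<sigma> (Suc (\<tau> n))) z)))"
    using V(3) unfolding normal_family_def by blast
  define \<upsilon> where "\<upsilon> = (\<lambda>n. \<sigma> (Suc (\<tau> n)))"
  have \<upsilon>: "strict_mono \<upsilon>"
    using \<sigma>(1) \<tau>(1) by (simp add: \<upsilon>_def strict_mono_def)
  have div': "filterlim (\<lambda>n. norm ((g ^^ \<upsilon> n) (q (\<upsilon> n)))) at_top sequentially"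
    using filterlim_compose[OF div filterlim_subseq[OF \<upsilon>]] .
  have "strict_mono (\<lambda>n. Suc (\<tau> n))"
    using \<tau>(1) by (simp add: strict_mono_def)
  then have "(\<lambda>n. q (\<upsilon> n)) \<longlonglongrightarrow> q'"
    using LIMSEQ_subseq_LIMSEQ[OF \<sigma>(2)] by (fastforce simp: \<upsilon>_def o_def)
  then have near: "\<forall>\<^sub>F n in sequentially. q (\<upsilon> n) \<in> cball q' r"
    using r(1) by (auto simp: tendsto_iff dist_commute elim!: eventually_mono dest!: spec[of _ r])
  have div_q': "filterlim (\<lambda>n. norm ((g ^^ \<upsilon> n) q')) at_top sequentially"
    using \<tau>(2)
  proof
    assume "\<exists>G. \<forall>K. compact K \<and> K \<subseteq> V \<longrightarrow> uniform_limit K (\<lambda>n. g ^^ \<sigma> (Suc (\<tau> n))) G sequentially"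
    then obtain G where "uniform_limit (cball q' r) (\<lambda>n. g ^^ \<sigma> (Suc (\<tau> n))) G sequentially"
      using r(2) compact_cball by metis
    then have G: "uniform_limit (cball q' r) (\<lambda>n. g ^^ \<upsilon> n) G sequentially"
      by (simp only: \<upsilon>_def)
    have "continuous_on (cball q' r) (g ^^ \<upsilon> n)" for n
      using entire_funpow[OF g] holomorphic_on_imp_continuous_on holomorphic_on_subset by blast
    then have "continuous_on (cball q' r) G"
      by (intro uniform_limit_theorem[OF _ G]) auto
    then have "bounded (G ` cball q' r)"
      by (intro compact_imp_bounded compact_continuous_image) auto
    then obtain B where B: "\<And>z. z \<in> cball q' r \<Longrightarrow> norm (G z) \<le> B"
      unfolding bounded_iff by blast
    have "\<forall>\<^sub>F n in sequentially. \<forall>z\<in>cball q' r. dist ((g ^^ \<upsilon> n) z) (G z) < 1"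
      using G unfolding uniform_limit_iff by auto
    moreover have "\<forall>\<^sub>F n in sequentially. norm ((g ^^ \<upsilon> n) (q (\<upsilon> n))) \<ge> B + 1"
      using div' unfolding filterlim_at_top by blast
    ultimately have "\<forall>\<^sub>F n in sequentially. False"
      using near
    proof eventually_elim
      case (elim n)
      then have "norm ((g ^^ \<upsilon> n) (q (\<upsilon> n)) - G (q (\<upsilon> n))) < 1" "norm (G (q (\<upsilon> n))) \<le> B"
        using B by (auto simp: dist_norm)
      then show ?case
        using elim(2) norm_triangle_sub[of "(g ^^ \<upsilon> n) (q (\<upsilon> n))" "G (q (\<upsilon> n))"] by linarith
    qed
    then show ?thesis by simp
  next
    assume *: "\<forall>K. compact K \<and> K \<subseteq> V \<longrightarrow>
      (\<forall>B. \<forall>\<^sub>F n in sequentially. \<forall>z\<in>K. B \<le> norm ((g ^^ \<sigma> (Suc (\<tau> n))) z))"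
    show ?thesis
      unfolding filterlim_at_top
      using *[rule_format, of "{q'}"] V(2) by (simp add: \<upsilon>_def)
  qed
  define D where "D = (\<lambda>z. filterlim (\<lambda>n. norm ((g ^^ \<upsilon> n) z)) at_top sequentially)"
  have "D z" if z: "z \<in> \<Gamma>" for z
  proof -
    \<comment> \<open>Divergence at one point of a neighbourhood of normality forces it at all
      others, so \<open>D\<close> is locally constant on \<open>\<Gamma>\<close>.\<close>
    have "D q' \<longleftrightarrow> D z"
    proof (rule connected_equivalence_relation[OF assms(3) q' z])
      fix a assume "a \<in> \<Gamma>"
      then obtain W where W: "open W" "a \<in> W" "normal_family {g ^^ n |n. n \<ge> 1} W"
        using assms(4) unfolding fatou_set_def by blast
      have "D y" if "x \<in> W" "y \<in> W" "D x" for x y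
      proof -
        have "range (\<lambda>n. g ^^ \<upsilon> n) \<subseteq> {g ^^ n |n. n \<ge> 1}"
          using ge1 by (auto simp: \<upsilon>_def)
        from normal_family_diverges[OF W(3) this that(1) that(3)[unfolded D_def], of "{y}"] that(2)
        show ?thesis
          by (simp add: D_def filterlim_at_top)
      qed
      with W show "\<exists>T. openin (top_of_set \<Gamma>) T \<and> a \<in> T \<and> (\<forall>x\<in>T. D a \<longleftrightarrow> D x)"
        by (intro exI[of _ "\<Gamma> \<inter> W"]) (auto simp: openin_open_Int \<open>a \<in> \<Gamma>\<close>)
    qed auto
    with div_q' show ?thesis by (simp add: D_def)
  qed
  then show ?thesis
    using that[of \<upsilon>] \<upsilon> ge1 by (simp add: D_def \<upsilon>_def)
qed

lemma fatou_set_local_Harnack: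
  assumes g: "entire g" and a: "a \<in> fatou_set g" and \<sigma>: "\<And>n. \<sigma> n \<ge> 1"
    and div: "filterlim (\<lambda>n. norm ((g ^^ \<sigma> n) a)) at_top sequentially"
  obtains \<rho> where "\<rho> > 0" "\<forall>\<^sub>F n in sequentially. \<forall>x\<in>ball a \<rho>. \<forall>y\<in>ball a \<rho>.
    norm ((g ^^ \<sigma> n) x) > 1 \<and> ln (norm ((g ^^ \<sigma> n) x)) \<le> 3 * ln (norm ((g ^^ \<sigma> n) y))"
proof -
  obtain W where W: "open W" "a \<in> W" "normal_family {g ^^ n |n. n \<ge> 1} W"
    using a unfolding fatou_set_def by blast
  obtain r where r: "r > 0" "cball a r \<subseteq> W"
    using W open_contains_cball by blast
  \<comment> \<open>Harnack comparison of two points of \<open>ball a \<rho>\<close>, less than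
    \<open>2 * \<rho>\<close> apart, needs a ball of radius \<open>4 * \<rho>\<close> about one of
    them, which stays within \<open>5 * \<rho> = r\<close> of \<open>a\<close>.\<close>
  define \<rho> where "\<rho> = r / 5"
  have "range (\<lambda>n. g ^^ \<sigma> n) \<subseteq> {g ^^ n |n. n \<ge> 1}"
    using \<sigma> by auto
  then have "\<forall>\<^sub>F n in sequentially. \<forall>w\<in>cball a r. 2 \<le> norm ((g ^^ \<sigma> n) w)"
    using normal_family_diverges[of _ W "\<lambda>n. g ^^ \<sigma> n", OF W(3) _ W(2) div _ r(2)] by auto
  then have "\<forall>\<^sub>F n in sequentially. \<forall>x\<in>ball a \<rho>. \<forall>y\<in>ball a \<rho>.
    norm ((g ^^ \<sigma> n) x) > 1 \<and> ln (norm ((g ^^ \<sigma> n) x)) \<le> 3 * ln (norm ((g ^^ \<sigma> n) y))"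
  proof eventually_elim
    case (elim n)
    have big: "norm ((g ^^ \<sigma> n) w) > 1" if "w \<in> cball a r" for w
      using elim that by fastforce
    show ?case
    proof (intro ballI conjI)
      fix x y assume xy: "x \<in> ball a \<rho>" "y \<in> ball a \<rho>"
      show "norm ((g ^^ \<sigma> n) x) > 1"
        using xy(1) r(1) by (intro big) (auto simp: \<rho>_def)
      show "ln (norm ((g ^^ \<sigma> n) x)) \<le> 3 * ln (norm ((g ^^ \<sigma> n) y))"
      proof (rule ln_norm_Harnack[of "g ^^ \<sigma> n" y "2 * \<rho>" x])
        show "(g ^^ \<sigma> n) holomorphic_on ball y (2 * (2 * \<rho>))"
          using entire_funpow[OF g] holomorphic_on_subset by blast
        show "x \<in> ball y (2 * \<rho>)"
          using xy dist_triangle3[of y x a] by simp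
        fix z assume "z \<in> ball y (2 * (2 * \<rho>))"
        then show "norm ((g ^^ \<sigma> n) z) > 1"
          using xy(2) dist_triangle[of a z y] by (intro big) (simp add: \<rho>_def)
      qed
    qed
  qed
  then show ?thesis
    using r(1) by (intro that[of \<rho>]) (auto simp: \<rho>_def)
qed

text \<open>Harnack's inequality is local, with constant 3. Eventual comparability up to some
  constant is an equivalence relation with open classes, so connectedness makes any two fixed points
  of \<open>\<Gamma>\<close> comparable. The moving points are reduced to fixed ones by passing to
  subsequences with limits \<open>p'\<close> and \<open>q'\<close>.\<close>

lemma fatou_set_log_ratio_bounded:
  assumes g: "entire g" and \<Gamma>: "compact \<Gamma>" "connected \<Gamma>" "\<Gamma> \<subseteq> fatou_set g"
    and p: "\<And>n. p n \<in> \<Gamma>" and q: "\<And>n. q n \<in> \<Gamma>"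
    and div: "filterlim (\<lambda>n. norm ((g ^^ n) (q n))) at_top sequentially"
  obtains \<sigma> :: "nat \<Rightarrow> nat" and C where "strict_mono \<sigma>" "C \<ge> 0"
    "\<forall>\<^sub>F n in sequentially. norm ((g ^^ \<sigma> n) (p (\<sigma> n))) > 1 \<and>
      ln (norm ((g ^^ \<sigma> n) (q (\<sigma> n)))) \<le> C * ln (norm ((g ^^ \<sigma> n) (p (\<sigma> n))))"
proof -
  obtain \<sigma> where \<sigma>: "strict_mono \<sigma>" "\<And>n. \<sigma> n \<ge> 1"
    "\<And>z. z \<in> \<Gamma> \<Longrightarrow> filterlim (\<lambda>n. norm ((g ^^ \<sigma> n) z)) at_top sequentially"
    using fatou_set_diverging_subsequence[OF g \<Gamma> q div] by blast
  obtain p' \<tau> where p': "p' \<in> \<Gamma>" and \<tau>: "strict_mono \<tau>" "((p \<circ> \<sigma>) \<circ> \<tau>) \<longlonglongrightarrow> p'"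
    using \<Gamma>(1)[unfolded compact_def, rule_format, of "p \<circ> \<sigma>"] p by auto
  obtain q' \<tau>' where q': "q' \<in> \<Gamma>" and \<tau>': "strict_mono \<tau>'" "((q \<circ> \<sigma> \<circ> \<tau>) \<circ> \<tau>') \<longlonglongrightarrow> q'"
    using \<Gamma>(1)[unfolded compact_def, rule_format, of "q \<circ> \<sigma> \<circ> \<tau>"] q by auto
  define \<upsilon> where "\<upsilon> = \<sigma> \<circ> \<tau> \<circ> \<tau>'"
  have \<upsilon>: "strict_mono \<upsilon>" "\<upsilon> n \<ge> 1" for n
    using \<sigma> \<tau>(1) \<tau>'(1) by (auto simp: \<upsilon>_def intro!: strict_mono_o)
  have p_lim: "(\<lambda>n. p (\<upsilon> n)) \<longlonglongrightarrow> p'" and q_lim: "(\<lambda>n. q (\<upsilon> n)) \<longlonglongrightarrow> q'"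
    using LIMSEQ_subseq_LIMSEQ[OF \<tau>(2) \<tau>'(1)] \<tau>'(2) by (simp_all add: \<upsilon>_def o_def)
  define L where "L = (\<lambda>n z. ln (norm ((g ^^ \<upsilon> n) z)))"
  have "strict_mono (\<tau> \<circ> \<tau>')"
    using \<tau>(1) \<tau>'(1) by (rule strict_mono_o)
  have "filterlim (\<lambda>n. norm ((g ^^ \<upsilon> n) z)) at_top sequentially" if "z \<in> \<Gamma>" for z
    using filterlim_compose[OF \<sigma>(3)[OF that] filterlim_subseq[OF \<open>strict_mono (\<tau> \<circ> \<tau>')\<close>]] by (simp add: \<upsilon>_def o_def)
  then have local: "\<exists>\<rho>>0. \<forall>\<^sub>F n in sequentially. \<forall>x\<in>ball a \<rho>. \<forall>y\<in>ball a \<rho>.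
      norm ((g ^^ \<upsilon> n) x) > 1 \<and> L n x \<le> 3 * L n y" if "a \<in> \<Gamma>" for a
    using fatou_set_local_Harnack[OF g, of a \<upsilon>] that \<Gamma>(3) \<upsilon>(2) unfolding L_def by blast
  define R where "R = (\<lambda>x y. \<exists>C\<ge>0. \<forall>\<^sub>F n in sequentially. L n x \<le> C * L n y \<and> L n y \<le> C * L n x)"
  have "R q' p'"
  proof (rule connected_equivalence_relation[OF \<Gamma>(2) q' p'])
    show "R y x" if "R x y" for x y
      using that by (simp add: R_def conj_commute)
    show "R x z" if "R x y" "R y z" for x y z
    proof -
      obtain C C' where C: "C \<ge> 0" "\<forall>\<^sub>F n in sequentially. L n x \<le> C * L n y \<and> L n y \<le> C * L n x"
        "C' \<ge> 0" "\<forall>\<^sub>F n in sequentially. L n y \<le> C' * L n z \<and> L n z \<le> C' * L n y"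
        using \<open>R x y\<close> \<open>R y z\<close> unfolding R_def by blast
      have "\<forall>\<^sub>F n in sequentially. L n x \<le> C * C' * L n z \<and> L n z \<le> C * C' * L n x"
        using C(2,4)
      proof eventually_elim
        case (elim n)
        have "C * L n y \<le> C * (C' * L n z)" "C' * L n y \<le> C' * (C * L n x)"
          using elim C by (auto intro: mult_left_mono)
        with elim show ?case
          by (simp add: mult.assoc mult.left_commute)
      qed
      then show ?thesis
        unfolding R_def using C(1,3) by (metis mult_nonneg_nonneg)
    qed
    fix a assume a: "a \<in> \<Gamma>"
    then obtain \<rho> where \<rho>: "\<rho> > 0" "\<forall>\<^sub>F n in sequentially. \<forall>x\<in>ball a \<rho>. \<forall>y\<in>ball a \<rho>.
      norm ((g ^^ \<upsilon> n) x) > 1 \<and> L n x \<le> 3 * L n y"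
      using local by blast
    have "R a x" if "x \<in> ball a \<rho>" for x
      unfolding R_def using \<rho> that
      by (intro exI[of _ 3]) (auto elim!: eventually_mono)
    with a \<rho>(1) show "\<exists>T. openin (top_of_set \<Gamma>) T \<and> a \<in> T \<and> (\<forall>x\<in>T. R a x)"
      by (intro exI[of _ "\<Gamma> \<inter> ball a \<rho>"]) (auto simp: openin_open_Int)
  qed
  then obtain C where C: "C \<ge> 0"
      "\<forall>\<^sub>F n in sequentially. L n q' \<le> C * L n p' \<and> L n p' \<le> C * L n q'"
    unfolding R_def by blast
  obtain \<rho>p where \<rho>p: "\<rho>p > 0" "\<forall>\<^sub>F n in sequentially. \<forall>x\<in>ball p' \<rho>p. \<forall>y\<in>ball p' \<rho>p.
      norm ((g ^^ \<upsilon> n) x) > 1 \<and> L n x \<le> 3 * L n y"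
    using local[OF p'] by blast
  obtain \<rho>q where \<rho>q: "\<rho>q > 0" "\<forall>\<^sub>F n in sequentially. \<forall>x\<in>ball q' \<rho>q. \<forall>y\<in>ball q' \<rho>q.
      norm ((g ^^ \<upsilon> n) x) > 1 \<and> L n x \<le> 3 * L n y"
    using local[OF q'] by blast
  have "\<forall>\<^sub>F n in sequentially. p (\<upsilon> n) \<in> ball p' \<rho>p" "\<forall>\<^sub>F n in sequentially. q (\<upsilon> n) \<in> ball q' \<rho>q"
    using tendstoD[OF p_lim \<rho>p(1)] tendstoD[OF q_lim \<rho>q(1)] by (simp_all add: dist_commute)
  \<comment> \<open>The factor is 3 from \<open>q (\<upsilon> n)\<close> to \<open>q'\<close>, then
    \<open>C\<close> from \<open>q'\<close> to \<open>p'\<close>, then 3 again from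
    \<open>p'\<close> to \<open>p (\<upsilon> n)\<close>.\<close>
  with C(2) \<rho>p(2) \<rho>q(2)
  have "\<forall>\<^sub>F n in sequentially. norm ((g ^^ \<upsilon> n) (p (\<upsilon> n))) > 1 \<and>
    L n (q (\<upsilon> n)) \<le> 9 * C * L n (p (\<upsilon> n))"
  proof eventually_elim
    case (elim n)
    have "L n (q (\<upsilon> n)) \<le> 3 * L n q'" "L n p' \<le> 3 * L n (p (\<upsilon> n))"
      using elim \<rho>p(1) \<rho>q(1) by auto
    moreover have "C * L n p' \<le> C * (3 * L n (p (\<upsilon> n)))"
      using calculation(2) C(1) by (rule mult_left_mono)
    ultimately show ?case
      using elim(1,2,4) by auto
  qed
  then show ?thesis
    using that[of \<upsilon> "9 * C"] \<upsilon>(1) C(1) by (simp add: L_def)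
qed

text \<open>On a path joining two suitable points of an unbounded component, stretching provides
  points \<open>p n\<close>, \<open>q n\<close> whose logarithmic ratio under the iterate is at
  least \<open>2 ^ n * T\<close> whenever the logarithm at \<open>p n\<close> is positive. Along a
  subsequence Harnack bounds this ratio by a fixed \<open>C\<close>.\<close>

lemma bounded_fatou_component:
  assumes g: "entire g" and "s > 1" "stretches s g" and U: "U \<in> components (fatou_set g)"
  shows "bounded U"
proof (rule ccontr)
  assume unbounded: "\<not> bounded U"
  have "open U" "connected U" "U \<noteq> {}" "U \<subseteq> fatou_set g"
    using U open_components[OF open_fatou_set] in_components_connected in_components_nonempty
      in_components_subset by blast+
  have "continuous_on UNIV g"
    using g by (rule holomorphic_on_imp_continuous_on)
  from stretches_funpow[OF assms(3,2) this]
  obtain T where T: "T > 0"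
    "\<And>t \<Gamma> n. \<lbrakk>t \<ge> T; connected \<Gamma>; \<exists>p\<in>\<Gamma>. norm p \<le> exp t; \<exists>q\<in>\<Gamma>. norm q \<ge> exp (T * t)\<rbrakk> \<Longrightarrow>
      \<exists>u\<ge>2 ^ n * T. \<exists>p\<in>\<Gamma>. \<exists>q\<in>\<Gamma>. norm ((g ^^ n) p) \<le> exp u \<and> norm ((g ^^ n) q) \<ge> exp (2 ^ n * T * u)"
    by blast
  obtain p0 where p0: "p0 \<in> U"
    using \<open>U \<noteq> {}\<close> by blast
  define t where "t = max T (norm p0)"
  have "norm p0 \<le> exp t"
    using exp_ge_add_one_self[of t] max.cobounded2[of "norm p0" T] unfolding t_def by linarith
  obtain q0 where q0: "q0 \<in> U" "norm q0 \<ge> exp (T * t)"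
    using unbounded unfolding bounded_iff by (metis linear)
  obtain \<gamma> where \<gamma>: "path \<gamma>" "path_image \<gamma> \<subseteq> U" "pathstart \<gamma> = p0" "pathfinish \<gamma> = q0"
    using connected_open_path_connected[OF \<open>open U\<close> \<open>connected U\<close>] p0 q0(1)
    unfolding path_connected_def by blast
  define \<Gamma> where "\<Gamma> = path_image \<gamma>"
  have \<Gamma>: "compact \<Gamma>" "connected \<Gamma>" "\<Gamma> \<subseteq> fatou_set g"
    using \<gamma> \<open>U \<subseteq> fatou_set g\<close> by (auto simp: \<Gamma>_def compact_path_image connected_path_image)
  have "p0 \<in> \<Gamma>" "q0 \<in> \<Gamma>"
    using \<gamma>(3,4) unfolding \<Gamma>_def by auto
  have "\<exists>u p q. u \<ge> 2 ^ n * T \<and> p \<in> \<Gamma> \<and> q \<in> \<Gamma> \<and> norm ((g ^^ n) p) \<le> exp u \<and>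
      norm ((g ^^ n) q) \<ge> exp (2 ^ n * T * u)" for n
    using T(2)[of t \<Gamma> n] \<Gamma>(2) \<open>p0 \<in> \<Gamma>\<close> \<open>q0 \<in> \<Gamma>\<close> \<open>norm p0 \<le> exp t\<close> q0(2) by (auto simp: t_def)
  then obtain u p q where upq: "\<And>n. u n \<ge> 2 ^ n * T" "\<And>n. p n \<in> \<Gamma>" "\<And>n. q n \<in> \<Gamma>"
      "\<And>n. norm ((g ^^ n) (p n)) \<le> exp (u n)" "\<And>n. norm ((g ^^ n) (q n)) \<ge> exp (2 ^ n * T * u n)"
    by metis
  have pow: "filterlim (\<lambda>n. 2 ^ n * T) at_top sequentially"
    using T(1) by (intro filterlim_at_top_mult_tendsto_pos[OF tendsto_const]
        filterlim_at_infinity_imp_filterlim_at_top filterlim_realpow_sequentially_gt1) auto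
  have u_pos: "u n > 0" for n
    using upq(1)[of n] T(1) by (smt (verit) mult_pos_pos zero_less_power)
  have "filterlim (\<lambda>n. norm ((g ^^ n) (q n))) at_top sequentially"
  proof (rule filterlim_at_top_mono)
    show "filterlim (\<lambda>n. (2 ^ n * T) * (2 ^ n * T)) at_top sequentially"
      by (intro filterlim_at_top_mult_at_top pow)
    show "\<forall>\<^sub>F n in sequentially. (2 ^ n * T) * (2 ^ n * T) \<le> norm ((g ^^ n) (q n))"
    proof (rule always_eventually, rule allI)
      fix n
      \<comment> \<open>The scale \<open>u n\<close> is itself at least \<open>2 ^ n * T\<close>, so
        the exponential lower bound at \<open>q n\<close> tends to infinity.\<close>
      have "(2 ^ n * T) * (2 ^ n * T) \<le> 2 ^ n * T * u n"
        using upq(1)[of n] T(1) by (intro mult_left_mono) auto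
      also have "\<dots> \<le> exp (2 ^ n * T * u n)"
        using exp_ge_add_one_self[of "2 ^ n * T * u n"] by linarith
      also have "\<dots> \<le> norm ((g ^^ n) (q n))"
        by (rule upq(5))
      finally show "(2 ^ n * T) * (2 ^ n * T) \<le> norm ((g ^^ n) (q n))" .
    qed
  qed
  then obtain \<sigma> :: "nat \<Rightarrow> nat" and C where \<sigma>: "strict_mono \<sigma>" "C \<ge> 0"
    "\<forall>\<^sub>F n in sequentially. norm ((g ^^ \<sigma> n) (p (\<sigma> n))) > 1 \<and>
      ln (norm ((g ^^ \<sigma> n) (q (\<sigma> n)))) \<le> C * ln (norm ((g ^^ \<sigma> n) (p (\<sigma> n))))"
    by (rule fatou_set_log_ratio_bounded[OF g \<Gamma> upq(2) upq(3)])
  have "\<forall>\<^sub>F n in sequentially. 2 ^ \<sigma> n * T > C"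
    using filterlim_compose[OF pow filterlim_subseq[OF \<sigma>(1)]] unfolding filterlim_at_top_dense
    by blast
  with \<sigma>(3) have "\<forall>\<^sub>F n in sequentially. False"
  proof eventually_elim
    case (elim n)
    define N where "N = \<sigma> n"
    have pos: "norm ((g ^^ N) (p N)) > 1" "norm ((g ^^ N) (q N)) > 0"
      using elim upq(5)[of N] less_le_trans[OF exp_gt_zero] by (auto simp: N_def)
    have "2 ^ N * T * u N \<le> ln (norm ((g ^^ N) (q N)))"
      using upq(5)[of N] pos(2) by (simp add: ln_ge_iff)
    also have "\<dots> \<le> C * ln (norm ((g ^^ N) (p N)))"
      using elim by (simp add: N_def)
    also have "\<dots> \<le> C * u N"
    proof (intro mult_left_mono \<sigma>(2))
      have "ln (norm ((g ^^ N) (p N))) \<le> ln (exp (u N))"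
        using upq(4)[of N] pos(1) by (subst ln_le_cancel_iff) auto
      then show "ln (norm ((g ^^ N) (p N))) \<le> u N" by simp
    qed
    finally have "2 ^ N * T \<le> C"
      using u_pos[of N] by simp
    with elim show ?case by (simp add: N_def)
  qed
  then show False by simp
qed

section \<open>Boundedness for the composition of the given functions\<close>

theorem theorem7p2:
  fixes k :: nat and f :: "nat \<Rightarrow> complex \<Rightarrow> complex" and g :: "complex \<Rightarrow> complex"
  assumes "k \<ge> 1"
    and "\<And>j. j \<in> {1..k} \<Longrightarrow> entire (f j)"
    and "\<And>j. j \<in> {1..k} \<Longrightarrow> \<not> f j constant_on UNIV"
    and "\<And>j. j \<in> {1..k} \<Longrightarrow> \<exists>m>1. annular_domain_property m (f j)"
    and "\<exists>j\<in>{1..k}. transcendental_entire (f j) \<and> log_regular (f j)"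
    and "g = foldr (\<circ>) (map f [1..<Suc k]) id"
  shows "\<forall>U \<in> components (fatou_set g). bounded U"
proof -
  obtain i c where i: "i \<in> {1..k}" and c: "c > 0" "log_regular_with c (f i)"
    using assms(5) unfolding log_regular_def by blast
  \<comment> \<open>One log-regular factor is singled out and the others enter with the exponent of
    convexity; the product of the exponents is then at least \<open>1 + c\<close>.\<close>
  define s where "s = (\<lambda>j. if j = i then 1 + c else 1)"
  have stretches: "stretches (s j) (f j)" if j: "j \<in> {1..k}" for j
  proof -
    obtain m where m: "m > 1" "annular_domain_property m (f j)"
      using assms(4)[OF j] by blast
    have "power_growth (s j) (f j)"
      using power_growth_log_regular[OF assms(2,3)[OF i] c(2)]
        power_growth_nonconstant[OF assms(2,3)[OF j]] by (simp add: s_def)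
    then show ?thesis
      using c(1) by (intro stretches_annular_domain[OF assms(2,3)[OF j] m]) (auto simp: s_def)
  qed
  have js: "set [1..<Suc k] = {1..k}"
    by auto
  have s1: "s j \<ge> 1" for j
    using c(1) by (simp add: s_def)
  have "stretches (\<Prod>j\<leftarrow>[1..<Suc k]. s j) g"
    unfolding assms(6)
    using stretches_foldr_comp[of "[1..<Suc k]" f s] stretches s1 assms(2)
      holomorphic_on_imp_continuous_on unfolding js by blast
  moreover have "(\<Prod>j\<leftarrow>[1..<Suc k]. s j) > 1"
    using prod_list_ge_member[of "[1..<Suc k]" s i] s1 i c(1) unfolding js by (simp add: s_def)
  \<comment> \<open>Stated for arbitrary lists of indices, so that the induction can pass to the
    tail.\<close>
  moreover have "entire (foldr (\<circ>) (map f js) id)" if "set js \<subseteq> {1..k}" for js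
    using that
  proof (induction js)
    case (Cons j js)
    have "entire (foldr (\<circ>) (map f js) id)"
      by (rule Cons.IH) (use Cons.prems in simp)
    moreover have "entire (f j)"
      using Cons.prems by (intro assms(2)) simp
    ultimately show ?case
      unfolding foldr_comp_Cons by (rule holomorphic_on_compose_gen) simp
  qed (simp add: holomorphic_on_id)
  then have "entire g"
    unfolding assms(6) using js by blast
  ultimately show ?thesis
    using bounded_fatou_component by blast
qed

end
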